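(* Let $a_0\in\mathbb{R}$ with $|a_0|>1$, let $\sigma^2>0$, and let $\{e_t\}_{t\ge1}$ be Gaussian white noise of variance $\sigma^2$. Let $y_0=0$ and $y_t=a_0y_{t-1}+e_t$ for $t\ge1$, and for $N\ge2$ let $$\hat a_N:=\frac{\sum_{t=2}^N y_ty_{t-1}}{\sum_{t=1}^{N-1}y_t^2}$$ be the least squares estimate of $a_0$ from $y_1,\dots,y_N$. Then for all $\varepsilon>0$ and all integers $N\ge2$, $$\mathbb{P}(\hat a_N-a_0>\varepsilon)\le\left(\frac{\lambda_2-\lambda_1}{(\lambda_2-1)\lambda_1^{N}-(\lambda_1-1)\lambda_2^{N}}\right)^{\frac14},$$ where $$\lambda_1=\frac{1+a_0^2+\varepsilon^2}{2}-\frac{\sqrt{(1+a_0^2+\varepsilon^2)^2-4a_0^2}}{2},\qquad \lambda_2=\frac{1+a_0^2+\varepsilon^2}{2}+\frac{\sqrt{(1+a_0^2+\varepsilon^2)^2-4a_0^2}}{2}.$$ Furthermore, for all integers $N\ge7$, $$\operatorname{var}\{\hat a_N\}\le|a_0|^{-\frac{2N}{5}}\left[\frac{2a_0^4(N+5)}{N}+8\sqrt[4]{\frac{N}{N+5}}\left(\frac{a_0^2}{N-6}-\frac{1}{N+2}\right)\right],$$ where $\operatorname{var}\{\hat a_N\}:=\mathbb{E}[(\hat a_N-a_0)^2]$.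
   Context: Gaussian white noise of variance $\sigma^2$ means that the $e_t$ are independent and identically distributed $\mathcal{N}(0,\sigma^2)$ random variables. The notation $\operatorname{var}\{\hat a_N\}$ denotes the mean squared deviation from the true parameter, $\mathbb{E}[(\hat a_N-a_0)^2]$ (not the variance centered at the mean of $\hat a_N$). The denominator of $\hat a_N$ is nonzero almost surely. *)

theory Defs
  imports "HOL-Probability.Probability"
begin

definition gaussian_white_noise :: "'a measure \<Rightarrow> real \<Rightarrow> (nat \<Rightarrow> 'a \<Rightarrow> real) \<Rightarrow> bool" where
  "gaussian_white_noise M \<sigma> e \<longleftrightarrow>
     prob_space.indep_vars M (\<lambda>_. borel) e {1..} \<and>
     (\<forall>t\<ge>1. distributed M lborel (e t) (normal_density 0 \<sigma>))"

text \<open>The value \<open>e 0\<close> is never used: the noise is indexed by times \<open>t \<ge> 1\<close>.\<close>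

primrec ar_process :: "real \<Rightarrow> (nat \<Rightarrow> 'a \<Rightarrow> real) \<Rightarrow> nat \<Rightarrow> 'a \<Rightarrow> real" where
  "ar_process a e 0 \<omega> = 0"
| "ar_process a e (Suc t) \<omega> = a * ar_process a e t \<omega> + e (Suc t) \<omega>"

definition ls_estimate :: "(nat \<Rightarrow> 'a \<Rightarrow> real) \<Rightarrow> nat \<Rightarrow> 'a \<Rightarrow> real" where
  "ls_estimate y N \<omega> =
     (\<Sum>t=2..N. y t \<omega> * y (t - 1) \<omega>) / (\<Sum>t=1..N - 1. (y t \<omega>)\<^sup>2)"

definition lambda1 :: "real \<Rightarrow> real \<Rightarrow> real" where
  "lambda1 a \<epsilon> =
     (1 + a\<^sup>2 + \<epsilon>\<^sup>2) / 2 - sqrt ((1 + a\<^sup>2 + \<epsilon>\<^sup>2)\<^sup>2 - 4 * a\<^sup>2) / 2"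

definition lambda2 :: "real \<Rightarrow> real \<Rightarrow> real" where
  "lambda2 a \<epsilon> =
     (1 + a\<^sup>2 + \<epsilon>\<^sup>2) / 2 + sqrt ((1 + a\<^sup>2 + \<epsilon>\<^sup>2)\<^sup>2 - 4 * a\<^sup>2) / 2"

text \<open>The mean squared deviation from \<open>\<theta>\<close>, not the variance centred at the mean of \<open>X\<close>.
  The Bochner integral is 0 for a non-integrable function, so a bound on this quantity
  has content only together with integrability.\<close>

definition mean_sq_dev :: "'a measure \<Rightarrow> ('a \<Rightarrow> real) \<Rightarrow> real \<Rightarrow> real" where
  "mean_sq_dev M X \<theta> = (\<integral>\<omega>. (X \<omega> - \<theta>)\<^sup>2 \<partial>M)"

end

theory Submission imports Defs begin

text \<open>The error \<open>ls_estimate y N - a\<close> times \<open>\<Sum>t<N. (y t)\<^sup>2\<close> equals \<open>\<Sum>t<N. y t * e (t + 1)\<close>, so a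
  one-sided deviation by \<open>\<epsilon>\<close> means \<open>\<Sum>t<N. (y t * e (t + 1) - \<epsilon> * (y t)\<^sup>2) \<ge> 0\<close>. A Chernoff bound with
  parameter \<open>\<epsilon> / (2 * \<sigma>\<^sup>2)\<close> and Cauchy-Schwarz against a Gaussian likelihood ratio bound its
  probability by the square root of the expectation of \<open>exp (- \<epsilon>\<^sup>2 / (2 * \<sigma>\<^sup>2) * (\<Sum>t<N. (y t)\<^sup>2))\<close>.
  Integrating out the noise backwards in time shows that this expectation is \<open>d\<close> to the power
  \<open>-1/2\<close>, where the determinant \<open>d\<close> satisfies a linear recursion with characteristic roots
  \<open>lambda1\<close> and \<open>lambda2\<close>. Since \<open>d \<ge> x * (a\<^sup>2 + x) ^ (N - 2)\<close> for \<open>x = \<epsilon>\<^sup>2\<close>, integrating the tail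
  bound over \<open>x\<close> controls the mean squared deviation.\<close>

section \<open>The determinant recursion\<close>

text \<open>The first component at \<open>N\<close> is the determinant of \<open>I + x L\<^sup>T L\<close>, where \<open>L\<close> maps the noise \<open>e 1, \<dots>, e (N - 1)\<close>
  to the path \<open>y 1, \<dots>, y (N - 1)\<close>.\<close>

fun det_pair :: "real \<Rightarrow> real \<Rightarrow> nat \<Rightarrow> real \<times> real" where
  "det_pair a x 0 = (1, 0)"
| "det_pair a x (Suc n) =
     (let (\<alpha>, \<beta>) = det_pair a x n in (\<alpha> + x * \<beta>, \<alpha> + x * \<beta> + a\<^sup>2 * \<beta>))"

abbreviation det_alpha :: "real \<Rightarrow> real \<Rightarrow> nat \<Rightarrow> real" where
  "det_alpha a x n \<equiv> fst (det_pair a x n)"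

abbreviation det_beta :: "real \<Rightarrow> real \<Rightarrow> nat \<Rightarrow> real" where
  "det_beta a x n \<equiv> snd (det_pair a x n)"

lemma det_pair_bounds:
  assumes "x \<ge> 0"
  shows "det_alpha a x n \<ge> 1 \<and> det_beta a x n \<ge> 0"
proof (induction n)
  case (Suc n)
  have "x * det_beta a x n \<ge> 0" "a\<^sup>2 * det_beta a x n \<ge> 0"
    using Suc assms by simp_all
  then show ?case
    using Suc by (auto simp: case_prod_beta)
qed simp

text \<open>Dropping the nonnegative first component leaves growth by the factor
  \<open>a^2 + x\<close> per step. The index starts at \<open>Suc n\<close> because the second
  component is 0 at time 0 and 1 at time 1.\<close>

lemma det_beta_ge_power:
  assumes "x \<ge> 0"
  shows "det_beta a x (Suc n) \<ge> (a\<^sup>2 + x) ^ n"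
proof (induction n)
  case (Suc n)
  have "(a\<^sup>2 + x) ^ Suc n \<le> (a\<^sup>2 + x) * det_beta a x (Suc n)"
    using Suc assms by (simp add: mult_left_mono)
  also have "\<dots> \<le> det_beta a x (Suc (Suc n))"
    using det_pair_bounds[OF assms, of a "Suc n"]
    by (subst (2) det_pair.simps) (simp add: case_prod_beta algebra_simps del: det_pair.simps)
  finally show ?case .
qed simp

text \<open>One step of the recursion turns growth of the second component into growth of the first.
  The explicit dependence on \<open>x\<close> is what makes the tail bound integrable in
  \<open>x\<close>.\<close>

lemma det_alpha_ge:
  assumes "x \<ge> 0" "N \<ge> 2"
  shows "det_alpha a x N \<ge> x * (a\<^sup>2 + x) ^ (N - 2)"
proof -
  obtain n where N: "N = Suc (Suc n)"
    using \<open>N \<ge> 2\<close> by (metis add_2_eq_Suc le_Suc_ex)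
  have "x * (a\<^sup>2 + x) ^ n \<le> x * det_beta a x (Suc n)"
    using det_beta_ge_power[OF assms(1)] assms(1) by (intro mult_left_mono)
  also have "\<dots> \<le> det_alpha a x (Suc (Suc n))"
    using det_pair_bounds[OF assms(1), of a "Suc n"]
    by (subst (2) det_pair.simps) (simp add: case_prod_beta del: det_pair.simps)
  finally show ?thesis
    by (simp add: N del: det_pair.simps)
qed

text \<open>One step is multiplication by a 2 by 2 matrix with trace \<open>1 + a^2 + x\<close> and
  determinant \<open>a^2\<close>, so \<open>l1\<close> and \<open>l2\<close> are its eigenvalues.
  Multiplying by \<open>l2 - l1\<close> avoids division.\<close>

lemma det_pair_closed_form:
  fixes l1 l2 :: real
  assumes "l1 * l2 = a\<^sup>2" "l1 + l2 = 1 + a\<^sup>2 + x"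
  shows "(l2 - l1) * det_alpha a x n = (l2 - 1) * l1 ^ n - (l1 - 1) * l2 ^ n \<and>
         (l2 - l1) * det_beta a x n = l2 ^ n - l1 ^ n"
proof (induction n)
  case (Suc n)
  \<comment> \<open>This is minus the characteristic polynomial evaluated at 1.\<close>
  have x: "x = (l2 - 1) * (1 - l1)"
    using assms by (simp add: algebra_simps)
  have *: "(l2 - l1) * (det_alpha a x n + x * det_beta a x n) =
      (l2 - 1) * l1 ^ Suc n - (l1 - 1) * l2 ^ Suc n"
  proof -
    have "(l2 - l1) * (det_alpha a x n + x * det_beta a x n) =
        (l2 - l1) * det_alpha a x n + x * ((l2 - l1) * det_beta a x n)"
      by (simp add: algebra_simps)
    also have "\<dots> = (l2 - 1) * l1 ^ n - (l1 - 1) * l2 ^ n + x * (l2 ^ n - l1 ^ n)"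
      using Suc by simp
    also have "\<dots> = (l2 - 1) * l1 ^ Suc n - (l1 - 1) * l2 ^ Suc n"
      by (subst x) (simp add: algebra_simps)
    finally show ?thesis .
  qed
  have "(l2 - l1) * (det_alpha a x n + x * det_beta a x n + a\<^sup>2 * det_beta a x n) =
      (l2 - l1) * (det_alpha a x n + x * det_beta a x n) + a\<^sup>2 * ((l2 - l1) * det_beta a x n)"
    by (simp add: algebra_simps)
  also have "\<dots> = (l2 - 1) * l1 ^ Suc n - (l1 - 1) * l2 ^ Suc n + (l1 * l2) * (l2 ^ n - l1 ^ n)"
    using Suc * assms(1) by simp
  also have "\<dots> = l2 ^ Suc n - l1 ^ Suc n"
    by (simp add: algebra_simps)
  finally show ?case
    using * by (simp add: case_prod_beta)
qed simp

lemma lambda_quotient_eq: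
  assumes "\<epsilon> > 0"
  shows "(lambda2 a \<epsilon> - lambda1 a \<epsilon>) /
      ((lambda2 a \<epsilon> - 1) * lambda1 a \<epsilon> ^ N - (lambda1 a \<epsilon> - 1) * lambda2 a \<epsilon> ^ N) =
      1 / det_alpha a (\<epsilon>\<^sup>2) N"
proof -
  define D where "D = (1 + a\<^sup>2 + \<epsilon>\<^sup>2)\<^sup>2 - 4 * a\<^sup>2"
  \<comment> \<open>The discriminant is a difference of squares; both factors are positive for
    positive \<epsilon>, so the roots are real and distinct.\<close>
  have "D = ((1 + a)\<^sup>2 + \<epsilon>\<^sup>2) * ((1 - a)\<^sup>2 + \<epsilon>\<^sup>2)"
    by (simp add: D_def power2_eq_square algebra_simps)
  then have "D > 0"
    using assms by (simp add: add_nonneg_pos)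
  then have neq: "lambda2 a \<epsilon> - lambda1 a \<epsilon> \<noteq> 0"
    unfolding lambda1_def lambda2_def D_def[symmetric] by simp
  have "lambda1 a \<epsilon> * lambda2 a \<epsilon> = ((1 + a\<^sup>2 + \<epsilon>\<^sup>2)\<^sup>2 - (sqrt D)\<^sup>2) / 4"
    unfolding lambda1_def lambda2_def D_def[symmetric] by (simp add: field_simps power2_eq_square)
  also have "\<dots> = a\<^sup>2"
    using \<open>D > 0\<close> by (simp add: D_def)
  finally have "lambda1 a \<epsilon> * lambda2 a \<epsilon> = a\<^sup>2" .
  moreover have "lambda1 a \<epsilon> + lambda2 a \<epsilon> = 1 + a\<^sup>2 + \<epsilon>\<^sup>2"
    by (simp add: lambda1_def lambda2_def)
  ultimately have "(lambda2 a \<epsilon> - 1) * lambda1 a \<epsilon> ^ N - (lambda1 a \<epsilon> - 1) * lambda2 a \<epsilon> ^ N =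
      (lambda2 a \<epsilon> - lambda1 a \<epsilon>) * det_alpha a (\<epsilon>\<^sup>2) N"
    by (simp add: det_pair_closed_form)
  then show ?thesis
    using neq by simp
qed

section \<open>Gaussian integrals\<close>

lemma nn_integral_normal_density:
  "\<sigma> > 0 \<Longrightarrow> (\<integral>\<^sup>+x. normal_density \<mu> \<sigma> x \<partial>lborel) = 1"
  by (simp add: nn_integral_eq_integral normal_density_nonneg)

text \<open>Completing the square: the exponential tilt moves the mean of the normal density to
  \<open>c * \<sigma>^2\<close> and keeps its mass.\<close>

lemma nn_integral_exp_linear_normal:
  assumes "\<sigma> > 0"
  shows "(\<integral>\<^sup>+x. ennreal (exp (c * x - c\<^sup>2 * \<sigma>\<^sup>2 / 2)) * ennreal (normal_density 0 \<sigma> x) \<partial>lborel) = 1"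
proof -
  have "exp (c * x - c\<^sup>2 * \<sigma>\<^sup>2 / 2) * normal_density 0 \<sigma> x = normal_density (c * \<sigma>\<^sup>2) \<sigma> x" for x
  proof -
    have "c * x - c\<^sup>2 * \<sigma>\<^sup>2 / 2 + - x\<^sup>2 / (2 * \<sigma>\<^sup>2) = - (x - c * \<sigma>\<^sup>2)\<^sup>2 / (2 * \<sigma>\<^sup>2)"
      using assms by (simp add: field_simps power2_eq_square)
    then show ?thesis
      unfolding normal_density_def by (simp add: exp_add[symmetric])
  qed
  then show ?thesis
    using nn_integral_normal_density[OF assms, of "c * \<sigma>\<^sup>2"]
    by (simp add: ennreal_mult[symmetric] normal_density_nonneg)
qed

text \<open>Completing the square in \<open>x\<close> gives a constant times the normal density with
  mean \<open>?\<mu>\<close> and deviation \<open>?\<tau>\<close>. The weight \<open>q\<close>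
  becomes \<open>q / (1 + q)\<close>, which drives the backward recursion.\<close>

lemma nn_integral_exp_square_normal:
  assumes "\<sigma> > 0" "q \<ge> 0"
  shows "(\<integral>\<^sup>+x. ennreal (exp (- q * (m + x)\<^sup>2 / (2 * \<sigma>\<^sup>2))) * ennreal (normal_density 0 \<sigma> x) \<partial>lborel) =
    ennreal (exp (- (q / (1 + q)) * m\<^sup>2 / (2 * \<sigma>\<^sup>2)) / sqrt (1 + q))"
proof -
  let ?\<mu> = "- q * m / (1 + q)" and ?\<tau> = "\<sigma> / sqrt (1 + q)"
  let ?c = "exp (- (q / (1 + q)) * m\<^sup>2 / (2 * \<sigma>\<^sup>2)) / sqrt (1 + q)"
  have q: "1 + q > 0" using assms by simp
  have \<tau>: "?\<tau>\<^sup>2 = \<sigma>\<^sup>2 / (1 + q)"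
    using q by (simp add: power_divide)
  have "exp (- q * (m + x)\<^sup>2 / (2 * \<sigma>\<^sup>2)) * normal_density 0 \<sigma> x =
      ?c * normal_density ?\<mu> ?\<tau> x" for x
  proof -
    have "q * (m + x)\<^sup>2 + x\<^sup>2 = q / (1 + q) * m\<^sup>2 + (1 + q) * (x - ?\<mu>)\<^sup>2"
      using q by (simp add: divide_simps) (simp add: power2_eq_square algebra_simps)
    then have "- q * (m + x)\<^sup>2 / (2 * \<sigma>\<^sup>2) + - x\<^sup>2 / (2 * \<sigma>\<^sup>2) =
        - (q / (1 + q)) * m\<^sup>2 / (2 * \<sigma>\<^sup>2) + - ((1 + q) * (x - ?\<mu>)\<^sup>2) / (2 * \<sigma>\<^sup>2)"
      unfolding add_divide_distrib[symmetric] by (intro arg_cong2[where f = "(/)"]) auto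
    then have "exp (- q * (m + x)\<^sup>2 / (2 * \<sigma>\<^sup>2)) * exp (- x\<^sup>2 / (2 * \<sigma>\<^sup>2)) =
        exp (- (q / (1 + q)) * m\<^sup>2 / (2 * \<sigma>\<^sup>2)) * exp (- (x - ?\<mu>)\<^sup>2 / (2 * ?\<tau>\<^sup>2))"
      unfolding \<tau> by (simp add: exp_add[symmetric] mult.commute)
    moreover have "1 / sqrt (2 * pi * \<sigma>\<^sup>2) = 1 / sqrt (1 + q) * (1 / sqrt (2 * pi * ?\<tau>\<^sup>2))"
      unfolding \<tau> using q by (simp add: real_sqrt_mult real_sqrt_divide)
    ultimately show ?thesis
      unfolding normal_density_def by simp
  qed
  then have "(\<integral>\<^sup>+x. ennreal (exp (- q * (m + x)\<^sup>2 / (2 * \<sigma>\<^sup>2))) * ennreal (normal_density 0 \<sigma> x) \<partial>lborel) =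
      (\<integral>\<^sup>+x. ennreal ?c * ennreal (normal_density ?\<mu> ?\<tau> x) \<partial>lborel)"
    using q by (simp add: ennreal_mult[symmetric] normal_density_nonneg)
  also have "\<dots> = ennreal ?c"
    using q assms nn_integral_normal_density[of ?\<tau> ?\<mu>] by (subst nn_integral_cmult) auto
  finally show ?thesis .
qed

section \<open>Integrating out the last innovation\<close>

text \<open>By independence the joint law of the block \<open>J\<close> and of \<open>e k\<close> is
  a product, so Tonelli allows \<open>e k\<close> to be integrated first, against its
  density.\<close>

lemma (in prob_space) nn_integral_indep_vars_split:
  assumes ind: "indep_vars (\<lambda>_. borel) e I" and J: "J \<subseteq> I" "k \<in> I - J"
    and d: "distributed M lborel (e k) (\<lambda>x. ennreal (h x))"
    and f: "case_prod f \<in> borel_measurable (PiM J (\<lambda>_. borel) \<Otimes>\<^sub>M borel)"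
  shows "(\<integral>\<^sup>+\<omega>. f (\<lambda>i\<in>J. e i \<omega>) (e k \<omega>) \<partial>M) =
    (\<integral>\<^sup>+\<omega>. \<integral>\<^sup>+x. f (\<lambda>i\<in>J. e i \<omega>) x * ennreal (h x) \<partial>lborel \<partial>M)"
proof -
  let ?N = "PiM J (\<lambda>_. borel)" and ?N' = "PiM {k} (\<lambda>_. borel)"
  define X where "X = (\<lambda>\<omega>. \<lambda>i\<in>J. e i \<omega>)"
  \<comment> \<open>The single variable is treated as a block of one index, since independence of
    blocks is a statement about restricted families.\<close>
  define Y where "Y = (\<lambda>\<omega>. \<lambda>i\<in>{k}. e i \<omega>)"
  have iXY: "indep_var ?N X ?N' Y"
    unfolding X_def Y_def using indep_var_restrict[OF ind, of J "{k}"] J by auto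
  then have X[measurable]: "X \<in> measurable M ?N" and Y[measurable]: "Y \<in> measurable M ?N'"
    by (auto dest: indep_var_rv1 indep_var_rv2)
  have e[measurable]: "e k \<in> borel_measurable M"
    using distributed_measurable[OF d] by simp
  have h[measurable]: "(\<lambda>x. ennreal (h x)) \<in> borel_measurable borel"
    using distributed_borel_measurable[OF d] by simp
  have ed: "distr M borel (e k) = density lborel (\<lambda>x. ennreal (h x))"
    using distributed_distr_eq_density[OF d] by (metis distr_cong sets_lborel)
  interpret Y: prob_space "distr M ?N' Y" by (rule prob_space_distr) fact
  note f[measurable]
  have [measurable]: "(\<lambda>v. v k) \<in> ?N' \<rightarrow>\<^sub>M borel"
    by (rule measurable_component_singleton) simp
  have "(\<integral>\<^sup>+\<omega>. f (X \<omega>) (e k \<omega>) \<partial>M) =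
      (\<integral>\<^sup>+z. f (fst z) (snd z k) \<partial>distr M (?N \<Otimes>\<^sub>M ?N') (\<lambda>\<omega>. (X \<omega>, Y \<omega>)))"
    by (subst nn_integral_distr) (measurable, simp add: Y_def)
  also have "\<dots> = (\<integral>\<^sup>+z. f (fst z) (snd z k) \<partial>(distr M ?N X \<Otimes>\<^sub>M distr M ?N' Y))"
    using iXY by (simp add: indep_var_distribution_eq)
  also have "\<dots> = (\<integral>\<^sup>+u. \<integral>\<^sup>+v. f u (v k) \<partial>distr M ?N' Y \<partial>distr M ?N X)"
    by (subst Y.nn_integral_fst[symmetric]) auto
  also have "\<dots> = (\<integral>\<^sup>+\<omega>. \<integral>\<^sup>+v. f (X \<omega>) (v k) \<partial>distr M ?N' Y \<partial>M)"
    by (subst nn_integral_distr) auto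
  also have "\<dots> = (\<integral>\<^sup>+\<omega>. \<integral>\<^sup>+x. f (X \<omega>) x * ennreal (h x) \<partial>lborel \<partial>M)"
  proof (rule nn_integral_cong)
    fix \<omega> assume "\<omega> \<in> space M"
    then have [measurable]: "f (X \<omega>) \<in> borel_measurable borel"
      using measurable_Pair2[OF f, of "X \<omega>"] measurable_space[OF X] by simp
    have "(\<integral>\<^sup>+v. f (X \<omega>) (v k) \<partial>distr M ?N' Y) = (\<integral>\<^sup>+x. f (X \<omega>) x \<partial>distr M borel (e k))"
      by (simp add: nn_integral_distr Y_def[symmetric]) (simp add: Y_def)
    then show "(\<integral>\<^sup>+v. f (X \<omega>) (v k) \<partial>distr M ?N' Y) = (\<integral>\<^sup>+x. f (X \<omega>) x * ennreal (h x) \<partial>lborel)"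
      unfolding ed by (subst (asm) nn_integral_density) (auto simp: mult.commute)
  qed
  finally show ?thesis by (simp add: X_def)
qed

section \<open>The autoregression driven by Gaussian noise\<close>

locale gaussian_ar = prob_space M for M :: "'a measure" +
  fixes e :: "nat \<Rightarrow> 'a \<Rightarrow> real" and a \<sigma> :: real
  assumes \<sigma>_pos: "\<sigma> > 0"
    and noise: "gaussian_white_noise M \<sigma> e"
begin

abbreviation y :: "nat \<Rightarrow> 'a \<Rightarrow> real" where
  "y \<equiv> ar_process a e"

lemma noise_measurable: "t \<ge> 1 \<Longrightarrow> e t \<in> borel_measurable M"
  using noise distributed_measurable[of M lborel "e t" "\<lambda>x. ennreal (normal_density 0 \<sigma> x)"]
  by (simp add: gaussian_white_noise_def)

lemma ar_measurable [measurable]: "y n \<in> borel_measurable M"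
proof (induction n)
  case (Suc n)
  have "(\<lambda>\<omega>. a * y n \<omega> + e (Suc n) \<omega>) \<in> borel_measurable M"
    using Suc noise_measurable[of "Suc n"] by simp
  then show ?case by simp
qed simp

text \<open>Running the recursion on coordinate projections presents the path up to time
  \<open>n\<close> as a function of the noise vector, the form in which independence of the next
  noise applies.\<close>

lemma ar_eq_coordinate_process:
  "k \<le> n \<Longrightarrow> y k \<omega> = ar_process a (\<lambda>i w. w i) k (\<lambda>i\<in>{1..n}. e i \<omega>)"
  by (induction k) auto

lemma coordinate_process_measurable:
  "k \<le> n \<Longrightarrow> ar_process a (\<lambda>i w. w i) k \<in> borel_measurable (PiM {1..n} (\<lambda>_. borel))"
proof (induction k)
  case (Suc k)
  then have "(\<lambda>w. a * ar_process a (\<lambda>i w. w i) k w + w (Suc k))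
      \<in> borel_measurable (PiM {1..n} (\<lambda>_. borel))"
    by (intro borel_measurable_add borel_measurable_times measurable_component_singleton) auto
  moreover have "ar_process a (\<lambda>i w. w i) (Suc k) =
      (\<lambda>w. a * ar_process a (\<lambda>i w. w i) k w + w (Suc k))"
    by (simp add: fun_eq_iff)
  ultimately show ?case by metis
next
  case 0
  have "ar_process a (\<lambda>i w. w i) 0 = (\<lambda>w. 0)"
    by (simp add: fun_eq_iff)
  then show ?case by simp
qed

text \<open>The product and \<open>y n\<close> involve only \<open>e 1\<close> to
  \<open>e n\<close>, so the independent \<open>e (Suc n)\<close> occurs in the factor
  \<open>L\<close> alone and can be integrated out there.\<close>

lemma nn_integral_last_noise:
  assumes [measurable]: "case_prod K \<in> borel_measurable (borel \<Otimes>\<^sub>M borel)"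
    "case_prod L \<in> borel_measurable (borel \<Otimes>\<^sub>M borel)"
  shows "(\<integral>\<^sup>+\<omega>. (\<Prod>t<n. K (y t \<omega>) (e (Suc t) \<omega>)) * L (y n \<omega>) (e (Suc n) \<omega>) \<partial>M) =
    (\<integral>\<^sup>+\<omega>. (\<Prod>t<n. K (y t \<omega>) (e (Suc t) \<omega>)) *
      (\<integral>\<^sup>+x. L (y n \<omega>) x * ennreal (normal_density 0 \<sigma> x) \<partial>lborel) \<partial>M)"
proof -
  let ?N = "PiM {1..n} (\<lambda>_. borel) :: (nat \<Rightarrow> real) measure"
  let ?y = "ar_process a (\<lambda>i w. w i)"
  let ?P = "\<lambda>w. \<Prod>t<n. K (?y t w) (w (Suc t)) :: ennreal"
  have ind: "indep_vars (\<lambda>_. borel) e {1..}"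
    using noise by (simp add: gaussian_white_noise_def)
  have d: "distributed M lborel (e (Suc n)) (\<lambda>x. ennreal (normal_density 0 \<sigma> x))"
    using noise by (simp add: gaussian_white_noise_def)
  have "(\<lambda>w. K (?y t w) (w (Suc t))) \<in> borel_measurable ?N" if "t < n" for t
  proof -
    have "(\<lambda>w. (?y t w, w (Suc t))) \<in> ?N \<rightarrow>\<^sub>M borel \<Otimes>\<^sub>M borel"
      using that by (intro measurable_Pair coordinate_process_measurable
        measurable_component_singleton) auto
    from measurable_compose[OF this assms(1)] show ?thesis by simp
  qed
  then have P[measurable]: "?P \<in> borel_measurable ?N"
    by (intro borel_measurable_prod_ennreal) auto
  have yn[measurable]: "?y n \<in> borel_measurable ?N"
    by (rule coordinate_process_measurable) simp
  have f: "(\<lambda>(w, x). ?P w * L (?y n w) x) \<in> borel_measurable (?N \<Otimes>\<^sub>M borel)"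
    by measurable
  have eqs: "?P (\<lambda>i\<in>{1..n}. e i \<omega>) = (\<Prod>t<n. K (y t \<omega>) (e (Suc t) \<omega>))"
    "?y n (\<lambda>i\<in>{1..n}. e i \<omega>) = y n \<omega>" for \<omega>
    by (auto simp: ar_eq_coordinate_process[of _ n] intro!: prod.cong)
  have "(\<integral>\<^sup>+\<omega>. (\<Prod>t<n. K (y t \<omega>) (e (Suc t) \<omega>)) * L (y n \<omega>) (e (Suc n) \<omega>) \<partial>M) =
    (\<integral>\<^sup>+\<omega>. \<integral>\<^sup>+x. (\<Prod>t<n. K (y t \<omega>) (e (Suc t) \<omega>)) * L (y n \<omega>) x *
      ennreal (normal_density 0 \<sigma> x) \<partial>lborel \<partial>M)"
    using nn_integral_indep_vars_split[OF ind _ _ d f] unfolding eqs by auto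
  also have "\<dots> = (\<integral>\<^sup>+\<omega>. (\<Prod>t<n. K (y t \<omega>) (e (Suc t) \<omega>)) *
      (\<integral>\<^sup>+x. L (y n \<omega>) x * ennreal (normal_density 0 \<sigma> x) \<partial>lborel) \<partial>M)"
    by (intro nn_integral_cong) (simp add: mult.assoc nn_integral_cmult)
  finally show ?thesis .
qed

text \<open>Given the past, each factor is a normal tilt with coefficient \<open>c * y t\<close> and
  has mean one, so the last factor can be removed repeatedly.\<close>

lemma nn_integral_likelihood_ratio:
  "(\<integral>\<^sup>+\<omega>. (\<Prod>t<n. ennreal (exp (c * y t \<omega> * e (Suc t) \<omega> - (c * y t \<omega>)\<^sup>2 * \<sigma>\<^sup>2 / 2))) \<partial>M) = 1"
proof (induction n)
  case 0
  show ?case by (simp add: emeasure_space_1)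
next
  case (Suc n)
  show ?case
    using nn_integral_last_noise[of "\<lambda>u x. ennreal (exp (c * u * x - (c * u)\<^sup>2 * \<sigma>\<^sup>2 / 2))"
        "\<lambda>u x. ennreal (exp (c * u * x - (c * u)\<^sup>2 * \<sigma>\<^sup>2 / 2))" n]
      nn_integral_exp_linear_normal[OF \<sigma>_pos] Suc
    by simp
qed

text \<open>The terminal weight \<open>q\<close> makes the induction go through: integrating out the
  last noise reproduces the same shape one step earlier with a new weight. The energy itself is the
  case \<open>q = 0\<close>.\<close>

lemma nn_integral_exp_energy:
  assumes "x \<ge> 0" "q \<ge> 0"
  shows "(\<integral>\<^sup>+\<omega>. (\<Prod>t<n. ennreal (exp (- x * (y t \<omega>)\<^sup>2 / (2 * \<sigma>\<^sup>2)))) *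
      ennreal (exp (- q * (y n \<omega>)\<^sup>2 / (2 * \<sigma>\<^sup>2))) \<partial>M) =
    ennreal (1 / sqrt (det_alpha a x n + q * det_beta a x n))"
  using \<open>q \<ge> 0\<close>
proof (induction n arbitrary: q)
  case 0
  show ?case by (simp add: emeasure_space_1)
next
  case (Suc n)
  \<comment> \<open>The weight passed to \<open>y n\<close>: its own \<open>x\<close>, plus what
    remains of \<open>q\<close> after averaging \<open>(a * y n + e (Suc n))^2\<close>.\<close>
  define q' where "q' = x + a\<^sup>2 * q / (1 + q)"
  have "q' \<ge> 0" using assms Suc.prems by (simp add: q'_def)
  define \<alpha> \<beta> where "\<alpha> = det_alpha a x n" and "\<beta> = det_beta a x n"
  let ?K = "\<lambda>u (v::real). ennreal (exp (- x * u\<^sup>2 / (2 * \<sigma>\<^sup>2)))"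
  let ?L = "\<lambda>u v. ennreal (exp (- x * u\<^sup>2 / (2 * \<sigma>\<^sup>2))) *
    ennreal (exp (- q * (a * u + v)\<^sup>2 / (2 * \<sigma>\<^sup>2)))"
  have L: "(\<integral>\<^sup>+v. ?L u v * ennreal (normal_density 0 \<sigma> v) \<partial>lborel) =
      ennreal (exp (- q' * u\<^sup>2 / (2 * \<sigma>\<^sup>2))) * ennreal (1 / sqrt (1 + q))" for u
  proof -
    have "(\<integral>\<^sup>+v. ?L u v * ennreal (normal_density 0 \<sigma> v) \<partial>lborel) =
      ennreal (exp (- x * u\<^sup>2 / (2 * \<sigma>\<^sup>2))) *
      ennreal (exp (- (q / (1 + q)) * (a * u)\<^sup>2 / (2 * \<sigma>\<^sup>2)) / sqrt (1 + q))"
      using nn_integral_exp_square_normal[OF \<sigma>_pos Suc.prems, of "a * u"]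
      by (simp add: mult.assoc nn_integral_cmult)
    also have "\<dots> = ennreal (exp (- x * u\<^sup>2 / (2 * \<sigma>\<^sup>2) + - (q / (1 + q)) * (a * u)\<^sup>2 / (2 * \<sigma>\<^sup>2)) *
        (1 / sqrt (1 + q)))"
      using Suc.prems by (subst exp_add) (simp add: ennreal_mult[symmetric])
    also have "- x * u\<^sup>2 / (2 * \<sigma>\<^sup>2) + - (q / (1 + q)) * (a * u)\<^sup>2 / (2 * \<sigma>\<^sup>2) = - q' * u\<^sup>2 / (2 * \<sigma>\<^sup>2)"
      unfolding add_divide_distrib[symmetric]
      by (intro arg_cong2[where f = "(/)"]) (simp_all add: q'_def power_mult_distrib ring_distribs)
    finally show ?thesis
      using Suc.prems by (simp add: ennreal_mult[symmetric])
  qed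
  have "(\<integral>\<^sup>+\<omega>. (\<Prod>t<Suc n. ?K (y t \<omega>) (e (Suc t) \<omega>)) *
      ennreal (exp (- q * (y (Suc n) \<omega>)\<^sup>2 / (2 * \<sigma>\<^sup>2))) \<partial>M) =
    (\<integral>\<^sup>+\<omega>. (\<Prod>t<n. ?K (y t \<omega>) (e (Suc t) \<omega>)) * ?L (y n \<omega>) (e (Suc n) \<omega>) \<partial>M)"
    by (simp add: mult.assoc)
  also have "\<dots> = (\<integral>\<^sup>+\<omega>. (\<Prod>t<n. ?K (y t \<omega>) (e (Suc t) \<omega>)) *
      (ennreal (exp (- q' * (y n \<omega>)\<^sup>2 / (2 * \<sigma>\<^sup>2))) * ennreal (1 / sqrt (1 + q))) \<partial>M)"
    by (subst nn_integral_last_noise) (simp_all only: L, measurable)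
  also have "\<dots> = ennreal (1 / sqrt (\<alpha> + q' * \<beta>)) * ennreal (1 / sqrt (1 + q))"
    using Suc.IH[OF \<open>q' \<ge> 0\<close>]
    by (simp add: mult.assoc[symmetric] nn_integral_multc \<alpha>_def \<beta>_def)
  also have "\<dots> = ennreal (1 / sqrt ((\<alpha> + q' * \<beta>) * (1 + q)))"
    using Suc.prems det_pair_bounds[OF assms(1), of a n] \<open>q' \<ge> 0\<close>
    by (simp add: ennreal_mult[symmetric] real_sqrt_mult \<alpha>_def \<beta>_def)
  \<comment> \<open>The recursion of \<open>det_pair\<close> is made for this identity: clearing the
    denominator of \<open>q'\<close> leaves an expression linear in \<open>q\<close>.\<close>
  also have "(\<alpha> + q' * \<beta>) * (1 + q) = det_alpha a x (Suc n) + q * det_beta a x (Suc n)"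
    using Suc.prems by (simp add: q'_def \<alpha>_def \<beta>_def case_prod_beta field_simps)
  finally show ?case by simp
qed

section \<open>The estimation error and its one-sided tails\<close>

lemma ls_estimate_measurable [measurable]: "ls_estimate y N \<in> borel_measurable M"
  unfolding ls_estimate_def [abs_def] by measurable

text \<open>Substituting the recursion into the numerator leaves only the noise terms. The
  multiplied-out form also covers a vanishing denominator, where the quotient is 0 by
  convention.\<close>

lemma ls_estimate_error:
  assumes "N \<ge> 2"
  defines "D \<equiv> \<lambda>\<omega>. \<Sum>t<N. (y t \<omega>)\<^sup>2"
  shows "(ls_estimate y N \<omega> - a) * D \<omega> = (\<Sum>t<N. y t \<omega> * e (Suc t) \<omega>)"
proof -
  \<comment> \<open>Since \<open>y 0 = 0\<close>, the extra index 0 changes neither sum.\<close>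
  have split: "{..<N} = insert 0 {1..N - 1}"
    using assms by auto
  have num: "(\<Sum>t=2..N. y t \<omega> * y (t - 1) \<omega>) = (\<Sum>t<N. y (Suc t) \<omega> * y t \<omega>)"
  proof -
    have "{2..N} = {Suc 1..Suc (N - 1)}"
      using assms by auto
    then have "(\<Sum>t=2..N. y t \<omega> * y (t - 1) \<omega>) = (\<Sum>t=1..N - 1. y (Suc t) \<omega> * y t \<omega>)"
      by (simp only: sum.shift_bounds_cl_Suc_ivl diff_Suc_1)
    then show ?thesis
      unfolding split by simp
  qed
  have den: "(\<Sum>t=1..N - 1. (y t \<omega>)\<^sup>2) = D \<omega>"
    unfolding D_def split by simp
  have err: "(\<Sum>t<N. y (Suc t) \<omega> * y t \<omega>) - a * D \<omega> = (\<Sum>t<N. y t \<omega> * e (Suc t) \<omega>)"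
    by (simp add: D_def sum_distrib_left sum_subtractf[symmetric] power2_eq_square algebra_simps)
  show ?thesis
  proof (cases "D \<omega> = 0")
    case True
    then have "\<forall>t<N. y t \<omega> = 0"
      by (auto simp: D_def sum_nonneg_eq_0_iff)
    with True show ?thesis by simp
  next
    case False
    then have "(ls_estimate y N \<omega> - a) * D \<omega> = (\<Sum>t<N. y (Suc t) \<omega> * y t \<omega>) - a * D \<omega>"
      unfolding ls_estimate_def num den by (simp add: left_diff_distrib)
    with err show ?thesis by simp
  qed
qed

text \<open>The Chernoff exponent is split as half a likelihood ratio, of mean one, plus half the
  quadratic energy; the weighted AM-GM inequality replaces Cauchy-Schwarz. The case of a vanishing
  denominator needs no separate treatment since then the exponent is zero.\<close>

lemma ls_estimate_tail:
  assumes "\<epsilon> > 0" "N \<ge> 2" "\<delta>\<^sup>2 = 1"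
  shows "measure M {\<omega> \<in> space M. \<delta> * (ls_estimate y N \<omega> - a) > \<epsilon>} \<le>
    (1 / det_alpha a (\<epsilon>\<^sup>2) N) powr (1 / 4)"
proof -
  define \<alpha> where "\<alpha> = det_alpha a (\<epsilon>\<^sup>2) N"
  have "\<alpha> \<ge> 1"
    using det_pair_bounds[of "\<epsilon>\<^sup>2"] by (simp add: \<alpha>_def)
  \<comment> \<open>The bound to be proved; its square is the expectation of \<open>V\<close>
    below.\<close>
  define b where "b = (1 / \<alpha>) powr (1 / 4)"
  have "b > 0" using \<open>\<alpha> \<ge> 1\<close> by (simp add: b_def)
  have b2: "1 / sqrt \<alpha> = b * b"
    using \<open>\<alpha> \<ge> 1\<close> unfolding b_def powr_add[symmetric]
    by (simp add: powr_half_sqrt real_sqrt_divide)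
  \<comment> \<open>Twice the Chernoff parameter, as the exponent is halved by the square root of
    \<open>U * V\<close>. The sign \<delta> handles both tails at once.\<close>
  define c where "c = \<delta> * \<epsilon> / \<sigma>\<^sup>2"
  define U where "U = (\<lambda>\<omega>. \<Prod>t<N. exp (c * y t \<omega> * e (Suc t) \<omega> - (c * y t \<omega>)\<^sup>2 * \<sigma>\<^sup>2 / 2))"
  define V where "V = (\<lambda>\<omega>. \<Prod>t<N. exp (- \<epsilon>\<^sup>2 * (y t \<omega>)\<^sup>2 / (2 * \<sigma>\<^sup>2)))"
  have e[measurable]: "e (Suc t) \<in> borel_measurable M" for t
    by (rule noise_measurable) simp
  have [measurable]: "U \<in> borel_measurable M" "V \<in> borel_measurable M"
    unfolding U_def V_def by measurable
  have pos: "U \<omega> > 0" "V \<omega> > 0" for \<omega>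
    by (auto simp: U_def V_def intro!: prod_pos)
  have EU: "(\<integral>\<^sup>+\<omega>. ennreal (U \<omega>) \<partial>M) = 1"
    using nn_integral_likelihood_ratio[where n = N and c = c] by (simp add: U_def prod_ennreal)
  have EV: "(\<integral>\<^sup>+\<omega>. ennreal (V \<omega>) \<partial>M) = ennreal (b * b)"
    using nn_integral_exp_energy[where x = "\<epsilon>\<^sup>2" and q = 0 and n = N] b2 by (simp add: V_def \<alpha>_def prod_ennreal)
  let ?A = "{\<omega> \<in> space M. \<delta> * (ls_estimate y N \<omega> - a) > \<epsilon>}"
  \<comment> \<open>The weights are balanced: as \<open>U\<close> has mean 1 and \<open>V\<close>
    has mean \<open>b * b\<close>, each term has expectation \<open>b / 2\<close>.\<close>
  have UV: "1 \<le> b / 2 * U \<omega> + 1 / (2 * b) * V \<omega>" if "\<omega> \<in> ?A" for \<omega>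
  proof -
    let ?D = "\<Sum>t<N. (y t \<omega>)\<^sup>2" and ?S = "\<Sum>t<N. y t \<omega> * e (Suc t) \<omega>"
    have "\<epsilon> * ?D \<le> \<delta> * (ls_estimate y N \<omega> - a) * ?D"
      using that by (intro mult_right_mono sum_nonneg) auto
    also have "\<dots> = \<delta> * ?S"
      using ls_estimate_error[OF assms(2)] by (simp add: mult.assoc)
    finally have S: "0 \<le> \<epsilon> / \<sigma>\<^sup>2 * (\<delta> * ?S - \<epsilon> * ?D)"
      using assms(1) by (intro mult_nonneg_nonneg) auto
    \<comment> \<open>For this \<open>c\<close> the compensator of \<open>U\<close> equals the
      exponent of \<open>V\<close>, and together they give the full quadratic term.\<close>
    have summand: "c * u * v - (c * u)\<^sup>2 * \<sigma>\<^sup>2 / 2 + - \<epsilon>\<^sup>2 * u\<^sup>2 / (2 * \<sigma>\<^sup>2) =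
        \<epsilon> / \<sigma>\<^sup>2 * (\<delta> * (u * v) - \<epsilon> * u\<^sup>2)" for u v
    proof -
      have "(c * u)\<^sup>2 * \<sigma>\<^sup>2 = \<delta>\<^sup>2 * \<epsilon>\<^sup>2 * u\<^sup>2 / \<sigma>\<^sup>2"
        using \<sigma>_pos by (simp add: c_def power2_eq_square)
      then show ?thesis
        unfolding assms(3) using \<sigma>_pos by (simp add: c_def field_simps power2_eq_square)
    qed
    have "U \<omega> * V \<omega> = exp (\<Sum>t<N. \<epsilon> / \<sigma>\<^sup>2 * (\<delta> * (y t \<omega> * e (Suc t) \<omega>) - \<epsilon> * (y t \<omega>)\<^sup>2))"
      unfolding U_def V_def prod.distrib[symmetric] exp_add[symmetric] summand by (simp add: exp_sum)
    also have "\<dots> = exp (\<epsilon> / \<sigma>\<^sup>2 * (\<delta> * ?S - \<epsilon> * ?D))"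
      by (simp add: sum_distrib_left sum_subtractf right_diff_distrib)
    finally have "1 \<le> U \<omega> * V \<omega>"
      using S by simp
    moreover have "4 * (U \<omega> * V \<omega>) \<le> (b * U \<omega> + V \<omega> / b)\<^sup>2"
      using \<open>b > 0\<close> zero_le_power2[of "b * U \<omega> - V \<omega> / b"]
      by (simp add: power2_eq_square algebra_simps)
    ultimately have "2\<^sup>2 \<le> (b * U \<omega> + V \<omega> / b)\<^sup>2"
      by simp
    then have "2 \<le> b * U \<omega> + V \<omega> / b"
      by (rule power2_le_imp_le) (use pos \<open>b > 0\<close> in \<open>simp add: less_imp_le\<close>)
    then show ?thesis by simp
  qed
  have "emeasure M ?A = (\<integral>\<^sup>+\<omega>. indicator ?A \<omega> \<partial>M)"
    by (subst nn_integral_indicator) auto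
  also have "\<dots> \<le> (\<integral>\<^sup>+\<omega>. ennreal (b / 2) * ennreal (U \<omega>) + ennreal (1 / (2 * b)) * ennreal (V \<omega>) \<partial>M)"
  proof (rule nn_integral_mono)
    fix \<omega>
    have "ennreal (b / 2) * ennreal (U \<omega>) + ennreal (1 / (2 * b)) * ennreal (V \<omega>) =
        ennreal (b / 2 * U \<omega> + 1 / (2 * b) * V \<omega>)"
      using \<open>b > 0\<close> pos[of \<omega>] by (simp add: ennreal_mult[symmetric] ennreal_plus[symmetric] del: ennreal_plus)
    then show "indicator ?A \<omega> \<le> ennreal (b / 2) * ennreal (U \<omega>) + ennreal (1 / (2 * b)) * ennreal (V \<omega>)"
      using UV[of \<omega>] by (auto simp: indicator_def ennreal_le_iff2 simp flip: ennreal_1)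
  qed
  also have "\<dots> = ennreal (b / 2) + ennreal (1 / (2 * b)) * ennreal (b * b)"
    by (simp add: nn_integral_add nn_integral_cmult EU EV)
  also have "\<dots> = ennreal b"
    using \<open>b > 0\<close> by (simp add: ennreal_mult[symmetric] ennreal_plus[symmetric] del: ennreal_plus)
  finally show ?thesis
    using \<open>b > 0\<close> by (simp add: emeasure_eq_measure b_def \<alpha>_def)
qed

end

section \<open>The mean squared deviation\<close>

text \<open>The layer cake formula: Tonelli for the region between 0 and the graph of
  \<open>f\<close>.\<close>

lemma (in sigma_finite_measure) nn_integral_eq_tail_integral:
  fixes f :: "'a \<Rightarrow> real"
  assumes [measurable]: "f \<in> borel_measurable M" and "\<And>\<omega>. f \<omega> \<ge> 0"
  shows "(\<integral>\<^sup>+\<omega>. ennreal (f \<omega>) \<partial>M) =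
    (\<integral>\<^sup>+x. emeasure M {\<omega> \<in> space M. f \<omega> > x} * indicator {0..} x \<partial>lborel)"
proof -
  interpret pair_sigma_finite M lborel ..
  have "(\<integral>\<^sup>+\<omega>. ennreal (f \<omega>) \<partial>M) = (\<integral>\<^sup>+\<omega>. \<integral>\<^sup>+x. indicator {0..<f \<omega>} x \<partial>lborel \<partial>M)"
    using assms(2) by (intro nn_integral_cong) simp
  also have "\<dots> = (\<integral>\<^sup>+\<omega>. \<integral>\<^sup>+x. (if x < f \<omega> then indicator {0..} x else 0) \<partial>lborel \<partial>M)"
    by (intro nn_integral_cong) (auto simp: indicator_def)
  also have "\<dots> = (\<integral>\<^sup>+x. \<integral>\<^sup>+\<omega>. (if x < f \<omega> then indicator {0..} x else 0) \<partial>M \<partial>lborel)"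
    by (rule Fubini'[symmetric]) measurable
  also have "\<dots> = (\<integral>\<^sup>+x. \<integral>\<^sup>+\<omega>. indicator {\<omega> \<in> space M. f \<omega> > x} \<omega> * indicator {0..} x \<partial>M \<partial>lborel)"
    by (intro nn_integral_cong) (auto simp: indicator_def)
  also have "\<dots> = (\<integral>\<^sup>+x. emeasure M {\<omega> \<in> space M. f \<omega> > x} * indicator {0..} x \<partial>lborel)"
    by (intro nn_integral_cong) (simp add: nn_integral_multc)
  finally show ?thesis .
qed

lemma nn_integral_shifted_powr:
  assumes "b > 0" "p > 1"
  shows "(\<integral>\<^sup>+x. ennreal ((b + x) powr (- p)) * indicator {0..} x \<partial>lborel) =
    ennreal (b powr (1 - p) / (p - 1))"
proof -
  have "(\<integral>\<^sup>+x. ennreal ((b + x) powr (- p)) * indicator {0..} x \<partial>lborel) =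
      ennreal (0 - (- ((b + 0) powr (1 - p) / (p - 1))))"
  proof (rule nn_integral_FTC_atLeast)
    have "((\<lambda>x. (b + x) powr (1 - p)) \<longlongrightarrow> 0) at_top"
      using assms by (intro tendsto_neg_powr filterlim_tendsto_add_at_top[OF tendsto_const]
        filterlim_ident) simp
    then have "((\<lambda>x. - ((b + x) powr (1 - p) / (p - 1))) \<longlongrightarrow> - (0 / (p - 1))) at_top"
      using assms by (intro tendsto_intros) auto
    then show "((\<lambda>x. - ((b + x) powr (1 - p) / (p - 1))) \<longlongrightarrow> 0) at_top"
      by simp
    fix x :: real assume "0 \<le> x"
    have "((\<lambda>x. (b + x) powr (1 - p)) has_real_derivative
        (1 - p) * (b + x) powr (- p)) (at x)"
      using assms \<open>0 \<le> x\<close> DERIV_fun_powr[of "\<lambda>x. b + x" 1 x "1 - p"]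
      by (auto intro!: derivative_eq_intros)
    moreover have "- ((1 - p) * (b + x) powr (- p) / (p - 1)) = (b + x) powr (- p)"
      using assms by (simp add: divide_simps) (simp add: algebra_simps)
    ultimately    show "DERIV (\<lambda>x. - ((b + x) powr (1 - p) / (p - 1))) x :> (b + x) powr (- p)"
      using DERIV_minus[OF DERIV_cdivide] by metis
  qed auto
  then show ?thesis by simp
qed

context gaussian_ar
begin

text \<open>Any cutoff \<open>x0\<close> works: below it the tail is bounded by one, above it by twice the
  one-sided bound.\<close>

lemma nn_integral_sq_error_le:
  assumes "N \<ge> 7" "x0 > 0" "a \<noteq> 0"
  shows "(\<integral>\<^sup>+\<omega>. ennreal ((ls_estimate y N \<omega> - a)\<^sup>2) \<partial>M) \<le>
    ennreal (x0 + 8 / (real N - 6) * x0 powr (- 1 / 4) * \<bar>a\<bar> powr (- (real N - 6) / 2))"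
proof -
  \<comment> \<open>The determinant grows with exponent \<open>N - 2\<close> and enters with power
    1/4. The bound \<open>N \<ge> 7\<close> gives \<open>p > 1\<close>, hence an integrable
    tail.\<close>
  define p where "p = (real N - 2) / 4"
  have p: "p > 1" "real (N - 2) = 4 * p" using assms(1) by (simp_all add: p_def)
  define c where "c = 2 * x0 powr (- 1 / 4)"
  have "c \<ge> 0" by (simp add: c_def)
  let ?Z = "\<lambda>\<omega>. (ls_estimate y N \<omega> - a)\<^sup>2"
  have tail: "emeasure M {\<omega> \<in> space M. ?Z \<omega> > x} \<le> ennreal (c * (a\<^sup>2 + x) powr (- p))" if "x \<ge> x0" for x
  proof -
    have x: "x > 0" using that assms by simp
    have ax: "a\<^sup>2 + x > 0" using x by (simp add: add_nonneg_pos)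
    let ?A = "\<lambda>\<delta>. {\<omega> \<in> space M. \<delta> * (ls_estimate y N \<omega> - a) > sqrt x}"
    \<comment> \<open>Freezing the leading factor at the cutoff leaves a pure power of
      \<open>a^2 + x\<close>, which integrates in closed form.\<close>
    have "x0 * (a\<^sup>2 + x) ^ (N - 2) \<le> x * (a\<^sup>2 + x) ^ (N - 2)"
      using that ax by (intro mult_right_mono) auto
    also have "\<dots> \<le> det_alpha a x N"
      using x assms by (intro det_alpha_ge) auto
    finally have *: "x0 * (a\<^sup>2 + x) ^ (N - 2) \<le> det_alpha a x N" .
    have "(1 / det_alpha a x N) powr (1 / 4) \<le> (1 / (x0 * (a\<^sup>2 + x) ^ (N - 2))) powr (1 / 4)"
      using * assms ax det_pair_bounds[of x a N] x
      by (intro powr_mono2 divide_left_mono mult_pos_pos) auto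
    also have "\<dots> = x0 powr (- 1 / 4) * (a\<^sup>2 + x) powr (- p)"
    proof -
      have "(1 / (x0 * (a\<^sup>2 + x) ^ (N - 2))) powr (1 / 4) =
         (x0 * (a\<^sup>2 + x) powr (4 * p)) powr (- (1 / 4))"
        using ax assms by (simp add: powr_realpow[symmetric] p powr_divide powr_minus_divide)
      also have "\<dots> = x0 powr (- 1 / 4) * (a\<^sup>2 + x) powr (- p)"
        using ax assms by (simp add: powr_mult powr_powr)
      finally show ?thesis .
    qed
    finally have bound: "measure M (?A \<delta>) \<le> x0 powr (- 1 / 4) * (a\<^sup>2 + x) powr (- p)"
      if "\<delta>\<^sup>2 = 1" for \<delta>
      using ls_estimate_tail[of "sqrt x" N \<delta>] that x assms by simp
    have "{\<omega> \<in> space M. ?Z \<omega> > x} \<subseteq> ?A 1 \<union> ?A (- 1)"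
    proof
      fix \<omega> assume "\<omega> \<in> {\<omega> \<in> space M. ?Z \<omega> > x}"
      then have "\<omega> \<in> space M" "sqrt x < \<bar>ls_estimate y N \<omega> - a\<bar>"
        using real_sqrt_less_mono[of x "?Z \<omega>"] by auto
      then show "\<omega> \<in> ?A 1 \<union> ?A (- 1)" by auto
    qed
    then have "measure M {\<omega> \<in> space M. ?Z \<omega> > x} \<le> measure M (?A 1 \<union> ?A (- 1))"
      by (intro finite_measure_mono) auto
    also have "\<dots> \<le> measure M (?A 1) + measure M (?A (- 1))"
      by (intro measure_Un_le) auto
    also have "\<dots> \<le> c * (a\<^sup>2 + x) powr (- p)"
      using bound[of 1] bound[of "- 1"] by (simp add: c_def)
    finally show ?thesis by (simp add: emeasure_eq_measure ennreal_leI)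
  qed
  have "(\<integral>\<^sup>+\<omega>. ennreal (?Z \<omega>) \<partial>M) =
      (\<integral>\<^sup>+x. emeasure M {\<omega> \<in> space M. ?Z \<omega> > x} * indicator {0..} x \<partial>lborel)"
    by (rule nn_integral_eq_tail_integral) auto
  \<comment> \<open>The power is integrated over the whole half-line, not just above
    \<open>x0\<close>; this only enlarges the bound.\<close>
  also have "\<dots> \<le> (\<integral>\<^sup>+x. indicator {0..x0} x +
      ennreal c * (ennreal ((a\<^sup>2 + x) powr (- p)) * indicator {0..} x) \<partial>lborel)"
  proof (rule nn_integral_mono)
    fix x :: real
    consider "x < 0" | "0 \<le> x" "x \<le> x0" | "x > x0" by linarith
    then show "emeasure M {\<omega> \<in> space M. ?Z \<omega> > x} * indicator {0..} x \<le> indicator {0..x0} x +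
      ennreal c * (ennreal ((a\<^sup>2 + x) powr (- p)) * indicator {0..} x)"
    proof cases
      case 2
      have "emeasure M {\<omega> \<in> space M. ?Z \<omega> > x} \<le> 1 + 0"
        by (simp add: emeasure_le_1)
      also have "\<dots> \<le> 1 + ennreal c * ennreal ((a\<^sup>2 + x) powr (- p))"
        by (intro add_left_mono) simp
      finally show ?thesis using 2 by simp
    next
      case 3
      then show ?thesis
        using tail[of x] assms \<open>c \<ge> 0\<close> by (simp add: ennreal_mult)
    qed simp
  qed
  also have "\<dots> = ennreal x0 + ennreal c * ennreal ((a\<^sup>2) powr (1 - p) / (p - 1))"
    using assms p by (simp add: nn_integral_add nn_integral_cmult nn_integral_shifted_powr)
  also have "\<dots> = ennreal (x0 + c * ((a\<^sup>2) powr (1 - p) / (p - 1)))"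
    using assms p \<open>c \<ge> 0\<close> by (simp add: ennreal_mult[symmetric] ennreal_plus[symmetric] del: ennreal_plus)
  also have "(a\<^sup>2) powr (1 - p) = \<bar>a\<bar> powr (- (real N - 6) / 2)"
  proof -
    have "a\<^sup>2 = \<bar>a\<bar> powr 2" using assms by simp
    moreover have "2 * (1 - p) = - (real N - 6) / 2"
      by (simp add: p_def field_simps)
    ultimately show ?thesis by (simp only: powr_powr)
  qed
  also have "c * (\<bar>a\<bar> powr (- (real N - 6) / 2) / (p - 1)) =
      8 / (real N - 6) * x0 powr (- 1 / 4) * \<bar>a\<bar> powr (- (real N - 6) / 2)"
    using assms(1) by (simp add: c_def p_def field_simps)
  finally show ?thesis .
qed

end

text \<open>With this cutoff both contributions decay like \<open>b\<close> to the power \<open>-2 N / 5\<close>; replacing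
  the factor 1 of the first one by 2 pays for the subtracted term.\<close>

lemma cutoff_bound:
  fixes b :: real
  assumes "b > 1" "N \<ge> 7"
  defines "x0 \<equiv> (real N + 5) / real N * b powr (4 - 2 * real N / 5)"
  shows "x0 + 8 / (real N - 6) * x0 powr (- 1 / 4) * b powr (- (real N - 6) / 2) \<le>
    b powr (- (2 * real N / 5)) *
      (2 * b ^ 4 * (real N + 5) / real N +
       8 * root 4 (real N / (real N + 5)) * (b\<^sup>2 / (real N - 6) - 1 / (real N + 2)))"
proof -
  define B where "B = b powr (- (2 * real N / 5))"
  define r where "r = root 4 (real N / (real N + 5))"
  define k where "k = (real N + 5) / real N"
  have N: "real N \<ge> 7" using assms(2) by simp
  have k: "k \<ge> 1" using N by (simp add: k_def)
  have r: "0 \<le> r" "r \<le> 1" using N by (simp_all add: r_def)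
  have "b powr (4 - 2 * real N / 5) = b ^ 4 * B"
  proof -
    have "b powr (4 - 2 * real N / 5) = b powr 4 * B"
      unfolding B_def powr_add[symmetric] by simp
    also have "b powr 4 = b ^ 4" using assms(1) by simp
    finally show ?thesis .
  qed
  then have x0: "x0 = k * b ^ 4 * B" by (simp add: x0_def k_def)
  \<comment> \<open>The exponents add up to
    \<open>(-1 + N/10) + (3 - N/2) = 2 - 2*N/5\<close>.\<close>
  have "x0 powr (- 1 / 4) * b powr (- (real N - 6) / 2) = r * (b\<^sup>2 * B)"
  proof -
    have "x0 powr (- 1 / 4) = k powr (- (1 / 4)) * b powr (- 1 + real N / 10)"
    proof -
      have "(4 - 2 * real N / 5) * (- 1 / 4) = - 1 + real N / 10"
        by (simp add: field_simps)
      then show ?thesis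
        using k assms(1) unfolding x0_def k_def[symmetric] by (simp add: powr_mult powr_powr)
    qed
    moreover have "k powr (- (1 / 4)) = r"
      using N by (simp add: r_def k_def root_powr_inverse powr_minus_divide powr_divide)
    moreover have "b powr (- 1 + real N / 10) * b powr (- (real N - 6) / 2) = b powr 2 * B"
      unfolding B_def powr_add[symmetric] by (intro arg_cong2[where f = "(powr)"]) (auto simp: field_simps)
    moreover have "b powr 2 = b\<^sup>2" using assms(1) by simp
    ultimately show ?thesis by simp
  qed
  then have "x0 + 8 / (real N - 6) * x0 powr (- 1 / 4) * b powr (- (real N - 6) / 2) =
      B * (k * b ^ 4 + 8 * r * (b\<^sup>2 / (real N - 6)))"
    by (simp add: x0 mult.assoc distrib_left mult_ac)
  also have "\<dots> \<le> B * (2 * (k * b ^ 4) + 8 * r * (b\<^sup>2 / (real N - 6) - 1 / (real N + 2)))"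
  proof (rule mult_left_mono)
    \<comment> \<open>Here \<open>r \<le> 1\<close> and \<open>N + 2 \<ge> 9\<close>; the second
      copy of \<open>k * b ^ 4\<close>, being at least 1, absorbs this term.\<close>
    have "8 * r * (1 / (real N + 2)) \<le> 1"
      using r N by (simp add: field_simps)
    moreover have "1 * 1 \<le> k * b ^ 4"
      using k assms(1) by (intro mult_mono) auto
    ultimately show "k * b ^ 4 + 8 * r * (b\<^sup>2 / (real N - 6)) \<le>
        2 * (k * b ^ 4) + 8 * r * (b\<^sup>2 / (real N - 6) - 1 / (real N + 2))"
      unfolding right_diff_distrib by linarith
  qed (simp add: B_def)
  finally show ?thesis
    by (simp add: B_def k_def r_def mult_ac)
qed

theorem theorem2:
  fixes M :: "'a measure" and e :: "nat \<Rightarrow> 'a \<Rightarrow> real" and a\<^sub>0 \<sigma> :: real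
  defines "y \<equiv> ar_process a\<^sub>0 e"
  assumes "prob_space M"
    and "\<bar>a\<^sub>0\<bar> > 1"
    and "\<sigma> > 0"
    and "gaussian_white_noise M \<sigma> e"
  shows "(\<forall>\<epsilon>>0. \<forall>N\<ge>2.
            measure M {\<omega> \<in> space M. ls_estimate y N \<omega> - a\<^sub>0 > \<epsilon>} \<le>
              ((lambda2 a\<^sub>0 \<epsilon> - lambda1 a\<^sub>0 \<epsilon>) /
                ((lambda2 a\<^sub>0 \<epsilon> - 1) * lambda1 a\<^sub>0 \<epsilon> ^ N - (lambda1 a\<^sub>0 \<epsilon> - 1) * lambda2 a\<^sub>0 \<epsilon> ^ N))
              powr (1 / 4)) \<and>
         (\<forall>N\<ge>7.
            integrable M (\<lambda>\<omega>. (ls_estimate y N \<omega> - a\<^sub>0)\<^sup>2) \<and>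
            mean_sq_dev M (ls_estimate y N) a\<^sub>0 \<le>
              \<bar>a\<^sub>0\<bar> powr (- (2 * real N / 5)) *
              (2 * a\<^sub>0 ^ 4 * (real N + 5) / real N +
               8 * root 4 (real N / (real N + 5)) *
                 (a\<^sub>0\<^sup>2 / (real N - 6) - 1 / (real N + 2))))"
proof -
  interpret ar: gaussian_ar M e a\<^sub>0 \<sigma>
    using assms by (simp add: gaussian_ar_def gaussian_ar_axioms_def)
  have "measure M {\<omega> \<in> space M. ls_estimate y N \<omega> - a\<^sub>0 > \<epsilon>} \<le>
      ((lambda2 a\<^sub>0 \<epsilon> - lambda1 a\<^sub>0 \<epsilon>) /
        ((lambda2 a\<^sub>0 \<epsilon> - 1) * lambda1 a\<^sub>0 \<epsilon> ^ N - (lambda1 a\<^sub>0 \<epsilon> - 1) * lambda2 a\<^sub>0 \<epsilon> ^ N))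
      powr (1 / 4)" if "\<epsilon> > 0" "N \<ge> 2" for \<epsilon> N
    using ar.ls_estimate_tail[of \<epsilon> N 1] that by (simp add: lambda_quotient_eq y_def)
  moreover have "integrable M (\<lambda>\<omega>. (ls_estimate y N \<omega> - a\<^sub>0)\<^sup>2) \<and>
      mean_sq_dev M (ls_estimate y N) a\<^sub>0 \<le>
        \<bar>a\<^sub>0\<bar> powr (- (2 * real N / 5)) *
        (2 * a\<^sub>0 ^ 4 * (real N + 5) / real N +
         8 * root 4 (real N / (real N + 5)) *
           (a\<^sub>0\<^sup>2 / (real N - 6) - 1 / (real N + 2)))" (is "?int \<and> _ \<le> ?R") if "N \<ge> 7" for N
  proof -
    define x0 where "x0 = (real N + 5) / real N * \<bar>a\<^sub>0\<bar> powr (4 - 2 * real N / 5)"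
    let ?B = "x0 + 8 / (real N - 6) * x0 powr (- 1 / 4) * \<bar>a\<^sub>0\<bar> powr (- (real N - 6) / 2)"
    have "x0 > 0" using assms(3) that by (simp add: x0_def)
    have B: "(\<integral>\<^sup>+\<omega>. ennreal ((ls_estimate y N \<omega> - a\<^sub>0)\<^sup>2) \<partial>M) \<le> ennreal ?B"
      unfolding y_def using that \<open>x0 > 0\<close> assms(3) by (intro ar.nn_integral_sq_error_le) auto
    \<comment> \<open>Finiteness of the nonnegative integral gives integrability, so
      \<open>mean_sq_dev\<close> is the true second moment and not the default value 0.\<close>
    have int: ?int
      using B by (intro integrableI_nonneg) (auto simp: y_def top.not_eq_extremum intro: le_less_trans)
    have "0 \<le> ?B" using \<open>x0 > 0\<close> that by simp
    then have "mean_sq_dev M (ls_estimate y N) a\<^sub>0 \<le> ?B"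
      using B nn_integral_eq_integral[OF int] by (simp add: mean_sq_dev_def ennreal_le_iff)
    \<comment> \<open>The cutoff estimate is applied with \<open>b = \<bar>a\<^sub>0\<bar>\<close>;
      the even powers remove the absolute value.\<close>
    also have "?B \<le> ?R"
      using cutoff_bound[OF assms(3) that] by (simp add: x0_def)
    finally show ?thesis using int by simp
  qed
  ultimately show ?thesis by blast
qed

end
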